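(* There is an algorithm which takes as input a polynomial $W(x_1,x_2,x_3,\ldots,x_m)$ with integer coefficients and returns a positive integer $v$ such that the following holds: if for all non-negative integers $x_1,x_2$, \[ x_2=f(x_1)\ (x_1\geq 1) \iff \exists x_3,\ldots,x_m\in\mathbb{N}\ \ W(x_1,x_2,x_3,\ldots,x_m)=0, \] then for every integer $u\geq v$ the equation $W(u,f(u),x_3,\ldots,x_m)=0$ has infinitely many solutions in non-negative integers $x_3,\ldots,x_m$.
   Context: $\mathbb{N}=\{0,1,2,\ldots\}$. For a positive integer $n$, let $E_n=\{x_i=1,\ x_i+x_j=x_k,\ x_i\cdot x_j=x_k : i,j,k\in\{1,\ldots,n\}\}$. Let $f(n)$ denote the smallest non-negative integer $b$ such that for each system $S\subseteq E_n$ with a finite number of solutions in integers $x_1,\ldots,x_n$, all these solutions belong to $[-b,b]^n$. *)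

theory Defs
  imports Complex_Main "HOL-Library.Poly_Mapping" "HOL-Library.Nat_Bijection" "HOL-Library.FuncSet"
begin

section \<open>The systems of equations and the bound on their solutions\<close>

datatype equation = One nat | Sum nat nat nat | Prod nat nat nat

definition E :: "nat \<Rightarrow> equation set" where
  "E n = {One i | i. i \<in> {1..n}}
       \<union> {Sum i j k | i j k. i \<in> {1..n} \<and> j \<in> {1..n} \<and> k \<in> {1..n}}
       \<union> {Prod i j k | i j k. i \<in> {1..n} \<and> j \<in> {1..n} \<and> k \<in> {1..n}}"

fun satisfies :: "(nat \<Rightarrow> int) \<Rightarrow> equation \<Rightarrow> bool" where
  "satisfies x (One i) \<longleftrightarrow> x i = 1"
| "satisfies x (Sum i j k) \<longleftrightarrow> x i + x j = x k"
| "satisfies x (Prod i j k) \<longleftrightarrow> x i * x j = x k"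

text \<open>Integer tuples indexed by \<open>{1..n}\<close> are extensional functions, so that finiteness
  of a solution set is not affected by the values outside of \<open>{1..n}\<close>.\<close>

definition solutions :: "nat \<Rightarrow> equation set \<Rightarrow> (nat \<Rightarrow> int) set" where
  "solutions n S = {x \<in> {1..n} \<rightarrow>\<^sub>E UNIV. \<forall>e\<in>S. satisfies x e}"

text \<open>Only the values at \<open>n \<ge> 1\<close> are meaningful.\<close>

definition f :: "nat \<Rightarrow> nat" where
  "f n = (LEAST b. \<forall>S. S \<subseteq> E n \<and> finite (solutions n S) \<longrightarrow>
                       solutions n S \<subseteq> {1..n} \<rightarrow>\<^sub>E {- int b..int b})"

lemma finite_E: "finite (E n)"
proof -
  have "E n = One ` {1..n} \<union> (\<lambda>(i, j, k). Sum i j k) ` ({1..n} \<times> {1..n} \<times> {1..n})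
             \<union> (\<lambda>(i, j, k). Prod i j k) ` ({1..n} \<times> {1..n} \<times> {1..n})"
    unfolding E_def by (auto simp: image_iff Bex_def)
  then show ?thesis
    by simp
qed

text \<open>The set whose least element is taken above is nonempty.\<close>

lemma f_exists:
  "\<exists>b. \<forall>S. S \<subseteq> E n \<and> finite (solutions n S) \<longrightarrow> solutions n S \<subseteq> {1..n} \<rightarrow>\<^sub>E {- int b..int b}"
proof -
  define X where "X = (\<Union>S \<in> {S. S \<subseteq> E n \<and> finite (solutions n S)}. solutions n S)"
  define V where "V = (\<lambda>(x, i). nat \<bar>x i\<bar>) ` (X \<times> {1..n})"
  have "finite X"
    unfolding X_def using finite_E by auto
  then have V: "finite V"
    unfolding V_def by simp
  show ?thesis
  proof (intro exI allI impI subsetI)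
    fix S x assume S: "S \<subseteq> E n \<and> finite (solutions n S)" and x: "x \<in> solutions n S"
    have "x i \<in> {- int (Max V)..int (Max V)}" if "i \<in> {1..n}" for i
    proof -
      have "x \<in> X"
        using S x unfolding X_def by blast
      then have "nat \<bar>x i\<bar> \<in> V"
        using that unfolding V_def by force
      then have "nat \<bar>x i\<bar> \<le> Max V"
        using V by simp
      then show ?thesis
        by auto
    qed
    moreover have "x \<in> {1..n} \<rightarrow>\<^sub>E UNIV"
      using x by (simp add: solutions_def)
    ultimately show "x \<in> {1..n} \<rightarrow>\<^sub>E {- int (Max V)..int (Max V)}"
      by (auto simp: PiE_def)
  qed
qed

section \<open>Polynomials with integer coefficients\<close>

text \<open>A monomial maps variable indices to exponents, a polynomial maps monomials to coefficients.\<close>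

type_synonym int_mpoly = "(nat \<Rightarrow>\<^sub>0 nat) \<Rightarrow>\<^sub>0 int"

definition vars :: "int_mpoly \<Rightarrow> nat set" where
  "vars W = (\<Union>\<mu> \<in> Poly_Mapping.keys W. Poly_Mapping.keys \<mu>)"

definition eval_poly :: "int_mpoly \<Rightarrow> (nat \<Rightarrow> int) \<Rightarrow> int" where
  "eval_poly W x =
    (\<Sum>\<mu> \<in> Poly_Mapping.keys W. Poly_Mapping.lookup W \<mu> *
       (\<Prod>i \<in> Poly_Mapping.keys \<mu>. x i ^ Poly_Mapping.lookup \<mu> i))"

text \<open>The tuples \<open>(x\<^sub>3, \<dots>, x\<^sub>m)\<close> of natural numbers with \<open>W(a, b, x\<^sub>3, \<dots>, x\<^sub>m) = 0\<close>.\<close>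

definition zeros_from :: "nat \<Rightarrow> int_mpoly \<Rightarrow> nat \<Rightarrow> nat \<Rightarrow> (nat \<Rightarrow> nat) set" where
  "zeros_from m W a b =
    {x \<in> {3..m} \<rightarrow>\<^sub>E UNIV. eval_poly W (\<lambda>i. int ((x(1 := a, 2 := b)) i)) = 0}"

text \<open>A polynomial in \<open>x\<^sub>1, \<dots>, x\<^sub>m\<close> is presented to an algorithm as \<open>m\<close> together with the list
  of its nonzero coefficients and their exponent vectors, in increasing order of the monomials.\<close>

definition encode_poly :: "nat \<Rightarrow> int_mpoly \<Rightarrow> nat" where
  "encode_poly m W =
    prod_encode (m, list_encode (map
      (\<lambda>\<mu>. prod_encode (int_encode (Poly_Mapping.lookup W \<mu>),
                        list_encode (map (Poly_Mapping.lookup \<mu>) [1..<Suc m])))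
      (sorted_list_of_set (Poly_Mapping.keys W))))"

section \<open>Algorithms\<close>

text \<open>Algorithms are programs for partial recursive functions. Programs need not be
  well-formed with respect to arities; an ill-formed application has no value.\<close>

datatype program =
    Zero
  | Succ
  | Proj nat
  | Comp program "program list"
  | PrimRec program program
  | Mu program

inductive computes :: "program \<Rightarrow> nat list \<Rightarrow> nat \<Rightarrow> bool" where
  zero: "computes Zero xs 0"
| succ: "computes Succ [x] (Suc x)"
| proj: "i < length xs \<Longrightarrow> computes (Proj i) xs (xs ! i)"
| comp: "list_all2 (\<lambda>g y. computes g xs y) gs ys \<Longrightarrow> computes p ys z \<Longrightarrow>
         computes (Comp p gs) xs z"
| prim_0: "computes p xs y \<Longrightarrow> computes (PrimRec p q) (0 # xs) y"
| prim_Suc: "computes (PrimRec p q) (n # xs) r \<Longrightarrow> computes q (n # r # xs) y \<Longrightarrow>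
             computes (PrimRec p q) (Suc n # xs) y"
| mu: "computes p (n # xs) 0 \<Longrightarrow> (\<forall>k<n. \<exists>y>0. computes p (k # xs) y) \<Longrightarrow>
       computes (Mu p) xs n"

lemma computes_deterministic: "computes p xs y \<Longrightarrow> computes p xs z \<Longrightarrow> y = z"
proof (induction arbitrary: z rule: computes.induct)
  case (comp xs gs ys p y)
  from comp.prems obtain ys' where *: "list_all2 (\<lambda>g y. computes g xs y) gs ys'" "computes p ys' z"
    by cases
  have "ys = ys'"
    using comp.IH(1) *(1) by (auto simp: list_all2_conv_all_nth intro!: nth_equalityI)
  then show ?case
    using comp.IH(2) *(2) by simp
next
  case (prim_Suc p q n xs r y)
  from prim_Suc.prems show ?case
    by cases (use prim_Suc.IH in blast)
next
  case (mu p n xs)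
  from mu.prems have z: "computes p (z # xs) 0" "\<forall>k<z. \<exists>y>0. computes p (k # xs) y"
    by (cases; blast)+
  have "\<not> n < z"
    using z(2) mu.IH(1) by fastforce
  moreover have "\<not> z < n"
    using z(1) mu.IH(2) by fastforce
  ultimately show ?case
    by simp
next
  case (prim_0 p xs y q)
  from prim_0.prems show ?case
    by cases (use prim_0.IH in blast)
next
  case (zero xs)
  then show ?case
    by cases simp
next
  case (succ x)
  then show ?case
    by cases simp
next
  case (proj i xs)
  from proj.prems show ?case
    by cases simp
qed

text \<open>The encoding loses no information about the polynomial.\<close>

lemma encode_poly_inject:
  assumes "vars W \<subseteq> {1..m}" "vars W' \<subseteq> {1..m'}" "encode_poly m W = encode_poly m' W'"
  shows "m = m' \<and> W = W'"
proof -
  let ?e = "\<lambda>\<mu>. map (Poly_Mapping.lookup \<mu>) [1..<Suc m]"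
  let ?L = "\<lambda>W. map (\<lambda>\<mu>. (Poly_Mapping.lookup W \<mu>, ?e \<mu>))
                  (sorted_list_of_set (Poly_Mapping.keys W))"
  let ?c = "\<lambda>(a, es). prod_encode (int_encode a, list_encode es)"
  have m: "m = m'"
    using assms(3) by (simp add: encode_poly_def)
  have "inj ?c"
    by (auto simp: inj_def inj_eq[OF inj_int_encode] inj_eq[OF inj_list_encode])
  moreover have "map ?c (?L W) = map ?c (?L W')"
    using assms(3) m
    by (auto simp: encode_poly_def comp_def inj_eq[OF inj_list_encode] simp del: upt_Suc)
  ultimately have "?L W = ?L W'"
    by (rule map_injective[rotated])
  then have eq: "set (?L W) = set (?L W')"
    by (rule arg_cong)
  have e_inj: "\<mu> = \<nu>"
    if "?e \<mu> = ?e \<nu>" "Poly_Mapping.keys \<mu> \<subseteq> {1..m}" "Poly_Mapping.keys \<nu> \<subseteq> {1..m}" for \<mu> \<nu>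
  proof (rule poly_mapping_eqI)
    fix i
    show "Poly_Mapping.lookup \<mu> i = Poly_Mapping.lookup \<nu> i"
    proof (cases "i \<in> {1..m}")
      case True
      then show ?thesis
        using that(1) by (auto simp del: upt_Suc)
    next
      case False
      then have "i \<notin> Poly_Mapping.keys \<mu>" "i \<notin> Poly_Mapping.keys \<nu>"
        using that(2,3) by blast+
      then show ?thesis
        by (simp add: in_keys_iff)
    qed
  qed
  have sub: "Poly_Mapping.lookup B \<mu> = Poly_Mapping.lookup A \<mu>"
    if "set (?L A) = set (?L B)" "vars A \<subseteq> {1..m}" "vars B \<subseteq> {1..m}" "\<mu> \<in> Poly_Mapping.keys A"
    for A B \<mu>
  proof -
    have "(Poly_Mapping.lookup A \<mu>, ?e \<mu>) \<in> set (?L B)"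
      unfolding that(1)[symmetric] using that(4) by (auto simp del: upt_Suc)
    then obtain \<nu> where \<nu>: "\<nu> \<in> Poly_Mapping.keys B"
      "Poly_Mapping.lookup A \<mu> = Poly_Mapping.lookup B \<nu>" "?e \<mu> = ?e \<nu>"
      by (auto simp del: upt_Suc)
    have "\<mu> = \<nu>"
      using that(2-4) \<nu>(1) by (intro e_inj[OF \<nu>(3)]) (auto simp: vars_def)
    then show ?thesis
      using \<nu> by simp
  qed
  have "W = W'"
  proof (rule poly_mapping_eqI)
    fix \<mu>
    show "Poly_Mapping.lookup W \<mu> = Poly_Mapping.lookup W' \<mu>"
      using sub[OF eq, of \<mu>] sub[OF eq[symmetric], of \<mu>] assms(1,2) m
      by (metis in_keys_iff)
  qed
  with m show ?thesis ..
qed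

end

theory Submission
  imports Defs "HOL-Computational_Algebra.Primes"
begin

text \<open>
  Suppose that \<open>W(u, f(u), x\<^sub>3, \<dots>, x\<^sub>m) = 0\<close> has only finitely many solutions in natural numbers.
  Write each \<open>x\<^sub>i\<close> as a sum of four squares and introduce one integer unknown for every
  subexpression of \<open>W(x\<^sub>1, \<dots>, x\<^sub>m)\<close>, of \<open>x\<^sub>1 - u\<close> and of \<open>x\<^sub>2 + 1\<close>. The equations \<open>W = 0\<close> and
  \<open>x\<^sub>1 - u = 0\<close> force \<open>x\<^sub>2 = f(u)\<close>, so the resulting system has finitely many, but at least one,
  integer solutions, and in all of them the unknown for \<open>x\<^sub>2 + 1\<close> has the value \<open>f(u) + 1\<close>.
  This contradicts the definition of \<open>f\<close> as soon as the system has at most \<open>u\<close> unknowns. The part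
  coming from \<open>W\<close> has at most linearly many unknowns in the code of \<open>W\<close>, and \<open>u\<close> can be built
  with \<open>u div 2 + 7\<close> unknowns, so a linear function of the code suffices for \<open>v\<close>.
\<close>

section \<open>Sums of four squares\<close>

definition sum_four_squares :: "int \<Rightarrow> bool" where
  "sum_four_squares n \<longleftrightarrow> (\<exists>a b c d. n = a\<^sup>2 + b\<^sup>2 + c\<^sup>2 + d\<^sup>2)"

text \<open>Euler's four-square identity. Signs are arranged so that the last three terms vanish
  when the two quadruples agree, which the descent below exploits modulo \<open>m\<close>.\<close>

lemma sum_four_squares_mult:
  assumes "sum_four_squares m" "sum_four_squares n"
  shows "sum_four_squares (m * n)"
proof -
  obtain a b c d where m: "m = a\<^sup>2 + b\<^sup>2 + c\<^sup>2 + d\<^sup>2"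
    using assms(1) sum_four_squares_def by blast
  obtain x y z w where n: "n = x\<^sup>2 + y\<^sup>2 + z\<^sup>2 + w\<^sup>2"
    using assms(2) sum_four_squares_def by blast
  have "m * n = (a*x + b*y + c*z + d*w)\<^sup>2 + (a*y - b*x + c*w - d*z)\<^sup>2
              + (a*z - c*x + d*y - b*w)\<^sup>2 + (a*w - d*x + b*z - c*y)\<^sup>2"
    unfolding m n by algebra
  then show ?thesis
    unfolding sum_four_squares_def by blast
qed

text \<open>The last clause excludes \<open>y = -m/2\<close>, so that the extreme case of the
  descent also fixes the sign of each residue.\<close>

lemma symmetric_residue:
  fixes x m :: int
  assumes "m > 0"
  obtains y k where "x = y + m * k" "2 * \<bar>y\<bar> \<le> m" "2 * \<bar>y\<bar> = m \<Longrightarrow> 2 * y = m"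
proof
  define y where "y = (if 2 * (x mod m) \<le> m then x mod m else x mod m - m)"
  define k where "k = (if 2 * (x mod m) \<le> m then x div m else x div m + 1)"
  show "x = y + m * k"
    unfolding y_def k_def by (simp add: algebra_simps)
  have "0 \<le> x mod m" "x mod m < m"
    using assms by simp_all
  then have "2 * \<bar>y\<bar> \<le> m \<and> (2 * \<bar>y\<bar> = m \<longrightarrow> 2 * y = m)"
    unfolding y_def by (cases "2 * (x mod m) \<le> m") simp_all
  then show "2 * \<bar>y\<bar> \<le> m" "2 * \<bar>y\<bar> = m \<Longrightarrow> 2 * y = m"
    by simp_all
qed

text \<open>Take the residues of the four roots modulo \<open>m\<close> of least absolute value. If they are all \<open>0\<close> or
  all \<open>m / 2\<close>, then \<open>m\<^sup>2\<close> divides \<open>m * p\<close>, which is impossible; this gives \<open>0 < r < m\<close>.\<close>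

lemma prime_multiple_descent:
  fixes p m :: int
  assumes p: "prime p" and m: "1 < m" "m < p" and sq: "sum_four_squares (m * p)"
  shows "\<exists>r. 0 < r \<and> r < m \<and> sum_four_squares (r * p)"
proof -
  obtain a b c d where abcd: "m * p = a\<^sup>2 + b\<^sup>2 + c\<^sup>2 + d\<^sup>2"
    using sq sum_four_squares_def by blast
  obtain x A where x: "a = x + m * A" "2 * \<bar>x\<bar> \<le> m" "2 * \<bar>x\<bar> = m \<Longrightarrow> 2 * x = m"
    using symmetric_residue m by (metis zero_less_one order.strict_trans)
  obtain y B where y: "b = y + m * B" "2 * \<bar>y\<bar> \<le> m" "2 * \<bar>y\<bar> = m \<Longrightarrow> 2 * y = m"
    using symmetric_residue m by (metis zero_less_one order.strict_trans)
  obtain z C where z: "c = z + m * C" "2 * \<bar>z\<bar> \<le> m" "2 * \<bar>z\<bar> = m \<Longrightarrow> 2 * z = m"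
    using symmetric_residue m by (metis zero_less_one order.strict_trans)
  obtain w D where w: "d = w + m * D" "2 * \<bar>w\<bar> \<le> m" "2 * \<bar>w\<bar> = m \<Longrightarrow> 2 * w = m"
    using symmetric_residue m by (metis zero_less_one order.strict_trans)
  have not_dvd: "\<not> m dvd p"
    using p m by (metis One_nat_def int_one_le_iff_zero_less less_le_not_le less_irrefl
        normalize_int_def abs_of_pos dvd_refl order.strict_trans prime_int_iff zero_less_one)
  \<comment> \<open>Obtained by expanding \<open>a = x + m * A\<close> and its analogues in
    \<open>abcd\<close> and solving for the sum of the squared residues divided by
    \<open>m\<close>.\<close>
  define r where "r = p - 2 * (x*A + y*B + z*C + w*D) - m * (A\<^sup>2 + B\<^sup>2 + C\<^sup>2 + D\<^sup>2)"
  have r: "x\<^sup>2 + y\<^sup>2 + z\<^sup>2 + w\<^sup>2 = m * r"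
    using abcd unfolding r_def x(1) y(1) z(1) w(1) by algebra
  have bound: "4 * t\<^sup>2 \<le> m\<^sup>2" if "2 * \<bar>t\<bar> \<le> m" for t
    using power_mono[OF that, of 2] by (simp add: power_mult_distrib)
  have bound_eq: "2 * \<bar>t\<bar> = m" if "m\<^sup>2 \<le> 4 * t\<^sup>2" "2 * \<bar>t\<bar> \<le> m" for t
  proof -
    have "m\<^sup>2 \<le> (2 * \<bar>t\<bar>)\<^sup>2"
      using that(1) by (simp add: power_mult_distrib)
    then have "m \<le> 2 * \<bar>t\<bar>"
      by (rule power2_le_imp_le) simp
    then show ?thesis using that(2) by simp
  qed
  have "m * r \<ge> 0"
    unfolding r[symmetric] by simp
  then have "r \<ge> 0"
    using m by (simp add: zero_le_mult_iff)
  moreover have "r \<noteq> 0"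
  proof
    assume "r = 0"
    then have "x\<^sup>2 + y\<^sup>2 + z\<^sup>2 + w\<^sup>2 = 0"
      using r by simp
    then have "x\<^sup>2 = 0" "y\<^sup>2 = 0" "z\<^sup>2 = 0" "w\<^sup>2 = 0"
      using zero_le_power2[of x] zero_le_power2[of y] zero_le_power2[of z] zero_le_power2[of w]
      by linarith+
    then have "x = 0" "y = 0" "z = 0" "w = 0"
      by simp_all
    then have "m * p = m * (m * (A\<^sup>2 + B\<^sup>2 + C\<^sup>2 + D\<^sup>2))"
      unfolding abcd x(1) y(1) z(1) w(1) by algebra
    then have "p = m * (A\<^sup>2 + B\<^sup>2 + C\<^sup>2 + D\<^sup>2)"
      using m by simp
    then show False
      using not_dvd by simp
  qed
  moreover have "r < m"
  proof (rule ccontr)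
    assume "\<not> r < m"
    then have "m\<^sup>2 \<le> m * r"
      using m by (simp add: power2_eq_square)
    \<comment> \<open>Each of the four squares is at most \<open>m^2 / 4\<close> and they add up to
      at least \<open>m^2\<close>, so none can be smaller than \<open>m^2 / 4\<close>.\<close>
    then have "m\<^sup>2 \<le> 4 * x\<^sup>2" "m\<^sup>2 \<le> 4 * y\<^sup>2" "m\<^sup>2 \<le> 4 * z\<^sup>2" "m\<^sup>2 \<le> 4 * w\<^sup>2"
      using r bound[OF x(2)] bound[OF y(2)] bound[OF z(2)] bound[OF w(2)] by linarith+
    then have h: "2 * x = m" "2 * y = m" "2 * z = m" "2 * w = m"
      using bound_eq x y z w by blast+
    then have eqs: "x = y" "z = y" "w = y" "m = 2 * y"
      by linarith+
    \<comment> \<open>With every residue equal to \<open>m/2\<close>, each root contributes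
      \<open>m^2 * (1/4 + A + A^2)\<close>; the four quarters give the 1.\<close>
    have "m * p = m * (m * (1 + A + B + C + D + A\<^sup>2 + B\<^sup>2 + C\<^sup>2 + D\<^sup>2))"
      unfolding abcd x(1) y(1) z(1) w(1) unfolding eqs
      by (simp add: power2_eq_square algebra_simps)
    then have "p = m * (1 + A + B + C + D + A\<^sup>2 + B\<^sup>2 + C\<^sup>2 + D\<^sup>2)"
      using m by simp
    then show False
      using not_dvd by simp
  qed
  moreover have "sum_four_squares (r * p)"
  proof -
    \<comment> \<open>These are Euler's four terms for the roots and their residues, divided by
      \<open>m\<close>. Modulo \<open>m\<close> the quadruples agree, so the first term becomes
      \<open>m * r\<close> and the others cancel.\<close>
    let ?q1 = "r + A*x + B*y + C*z + D*w" and ?q2 = "A*y - B*x + C*w - D*z"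
    let ?q3 = "A*z - C*x + D*y - B*w" and ?q4 = "A*w - D*x + B*z - C*y"
    have "a*x + b*y + c*z + d*w = (x\<^sup>2 + y\<^sup>2 + z\<^sup>2 + w\<^sup>2) + m * (A*x + B*y + C*z + D*w)"
      unfolding x(1) y(1) z(1) w(1) by (simp add: power2_eq_square algebra_simps)
    also have "\<dots> = m * ?q1"
      unfolding r by (simp add: algebra_simps)
    finally have q: "a*x + b*y + c*z + d*w = m * ?q1" .
    have q': "a*y - b*x + c*w - d*z = m * ?q2"
      "a*z - c*x + d*y - b*w = m * ?q3" "a*w - d*x + b*z - c*y = m * ?q4"
      unfolding x(1) y(1) z(1) w(1) by (simp_all add: algebra_simps)
    have "m\<^sup>2 * (r * p) = (a\<^sup>2 + b\<^sup>2 + c\<^sup>2 + d\<^sup>2) * (x\<^sup>2 + y\<^sup>2 + z\<^sup>2 + w\<^sup>2)"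
      unfolding abcd[symmetric] r by (simp add: power2_eq_square)
    also have "\<dots> = (a*x + b*y + c*z + d*w)\<^sup>2 + (a*y - b*x + c*w - d*z)\<^sup>2
              + (a*z - c*x + d*y - b*w)\<^sup>2 + (a*w - d*x + b*z - c*y)\<^sup>2"
      by algebra
    also have "\<dots> = m\<^sup>2 * (?q1\<^sup>2 + ?q2\<^sup>2 + ?q3\<^sup>2 + ?q4\<^sup>2)"
      unfolding q q' by algebra
    finally have "r * p = ?q1\<^sup>2 + ?q2\<^sup>2 + ?q3\<^sup>2 + ?q4\<^sup>2"
      using m by simp
    then show ?thesis
      unfolding sum_four_squares_def by blast
  qed
  ultimately show ?thesis
    by (metis order_le_less)
qed

text \<open>Pigeonhole: for \<open>a\<close>, \<open>b\<close> in \<open>{0..(p-1)/2}\<close>, the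
  residues of \<open>a^2\<close> and of \<open>-1 - b^2\<close> each take \<open>(p+1)/2\<close>
  distinct values, so two of them coincide. The size bounds keep the resulting multiple of
  \<open>p\<close> below \<open>p^2\<close>.\<close>

lemma prime_dvd_sum_two_squares_plus_one:
  fixes p :: int
  assumes p: "prime p" "odd p"
  shows "\<exists>a b. 0 \<le> a \<and> 2 * a < p \<and> 0 \<le> b \<and> 2 * b < p \<and> p dvd a\<^sup>2 + b\<^sup>2 + 1"
proof -
  define h where "h = (p - 1) div 2"
  have p1: "p > 1" and h: "p = 2 * h + 1"
    using p prime_gt_1_int h_def by auto
  define I where "I = {0..h}"
  have inj: "a = b" if "a \<in> I" "b \<in> I" "p dvd a\<^sup>2 - b\<^sup>2" for a b
  proof -
    have "p dvd (a - b) * (a + b)"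
      using that(3) by (simp add: power2_eq_square algebra_simps)
    then have "p dvd a - b \<or> p dvd a + b"
      using p(1) by (simp add: prime_dvd_mult_iff)
    moreover have "\<bar>a - b\<bar> < p" "0 \<le> a + b" "a + b < p"
      using that(1,2) h p1 unfolding I_def by auto
    ultimately have "a - b = 0 \<or> a + b = 0"
      by (metis dvd_imp_le_int abs_of_nonneg abs_of_pos p1 not_le order.strict_trans zero_less_one)
    then show ?thesis
      using that(1,2) unfolding I_def by auto
  qed
  let ?f = "\<lambda>a. a\<^sup>2 mod p" and ?g = "\<lambda>b. (- 1 - b\<^sup>2) mod p"
  have "inj_on ?f I"
    by (rule inj_onI) (metis inj mod_eq_dvd_iff)
  moreover have "inj_on ?g I"
  proof (rule inj_onI)
    fix a b assume *: "a \<in> I" "b \<in> I" "?g a = ?g b"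
    then have "p dvd (- 1 - a\<^sup>2) - (- 1 - b\<^sup>2)"
      by (simp add: mod_eq_dvd_iff)
    then have "p dvd b\<^sup>2 - a\<^sup>2"
      by simp
    then show "a = b"
      using inj * by metis
  qed
  ultimately have "card (?f ` I) = card I" "card (?g ` I) = card I"
    by (simp_all add: card_image)
  moreover have "card (?f ` I \<union> ?g ` I) \<le> card {0..<p}"
    using p1 by (intro card_mono) auto
  moreover have "card (?f ` I \<inter> ?g ` I) = 0 \<Longrightarrow>
      card (?f ` I \<union> ?g ` I) = card (?f ` I) + card (?g ` I)"
    by (simp add: card_Un_disjoint I_def)
  moreover have "card I + card I > card {0..<p}"
    using h p1 by (simp add: I_def)
  ultimately have "?f ` I \<inter> ?g ` I \<noteq> {}"
    by (metis card.empty not_le)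
  then obtain a b where ab: "a \<in> I" "b \<in> I" "?f a = ?g b"
    by blast
  then have "p dvd a\<^sup>2 + b\<^sup>2 + 1"
    by (simp add: mod_eq_dvd_iff algebra_simps)
  then show ?thesis
    using ab(1,2) h unfolding I_def by (intro exI[of _ a] exI[of _ b]) auto
qed

lemma sum_four_squares_prime:
  fixes p :: int
  assumes p: "prime p"
  shows "sum_four_squares p"
proof (cases "p = 2")
  case True
  then have "p = 1\<^sup>2 + 1\<^sup>2 + 0\<^sup>2 + 0\<^sup>2" by simp
  then show ?thesis unfolding sum_four_squares_def by blast
next
  case False
  have p1: "p > 1"
    using p prime_gt_1_int by blast
  then have "odd p"
    using False p prime_odd_int by auto
  then obtain a b where ab: "0 \<le> a" "2 * a < p" "0 \<le> b" "2 * b < p" "p dvd a\<^sup>2 + b\<^sup>2 + 1"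
    using prime_dvd_sum_two_squares_plus_one[OF p] by blast
  then obtain k where k: "a\<^sup>2 + b\<^sup>2 + 1 = k * p"
    by (metis dvdE mult.commute)
  have "k * p > 0"
    unfolding k[symmetric] using zero_le_power2[of a] zero_le_power2[of b] by linarith
  then have k0: "k > 0"
    using p1 by (simp add: zero_less_mult_iff)
  have "(2 * a)\<^sup>2 \<le> (p - 1)\<^sup>2" "(2 * b)\<^sup>2 \<le> (p - 1)\<^sup>2"
    using ab by (intro power_mono; simp)+
  then have "2 * (a\<^sup>2 + b\<^sup>2) \<le> (p - 1)\<^sup>2"
    by (simp add: power_mult_distrib)
  also have "\<dots> = p * p - 2 * p + 1"
    by (simp add: power2_eq_square algebra_simps)
  finally have "2 * (a\<^sup>2 + b\<^sup>2) \<le> p * p - 2 * p + 1" .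
  moreover have "2 * 2 \<le> p * p"
    by (rule mult_mono) (use p1 in auto)
  moreover have "2 * (k * p) = 2 * (a\<^sup>2 + b\<^sup>2) + 2"
    by (simp flip: k)
  ultimately have "2 * (k * p) < 2 * (p * p)"
    using p1 by linarith
  then have kp: "k < p"
    using p1 by simp
  \<comment> \<open>Writing the multiplier as \<open>Suc n\<close> keeps it positive; the descent
    ends at \<open>n = 0\<close>, where the multiple is \<open>p\<close> itself.\<close>
  have "sum_four_squares (int (Suc n) * p) \<Longrightarrow> int (Suc n) < p \<Longrightarrow> sum_four_squares p" for n
  proof (induction n rule: less_induct)
    case (less n)
    show ?case
    proof (cases "n = 0")
      case False
      then obtain r where r: "0 < r" "r < int (Suc n)" "sum_four_squares (r * p)"
        using prime_multiple_descent[OF p _ less.prems(2,1)] by auto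
      have "r = int (Suc (nat r - 1))"
        using r(1) by simp
      moreover have "nat r - 1 < n"
        using r(1,2) by linarith
      ultimately show ?thesis
        using less.IH less.prems(2) r by (metis order.strict_trans)
    qed (use less in simp)
  qed
  moreover have "sum_four_squares (k * p)"
    unfolding sum_four_squares_def k[symmetric]
    by (intro exI[of _ a] exI[of _ b] exI[of _ 1] exI[of _ 0]) simp
  moreover have "k = int (Suc (nat k - 1))"
    using k0 by simp
  ultimately show ?thesis
    using kp by metis
qed

text \<open>Lagrange's theorem: split off a prime factor and use multiplicativity.\<close>

theorem sum_four_squares_nat: "sum_four_squares (int n)"
proof (induction n rule: less_induct)
  case (less n)
  consider "n = 0" | "n = 1" | "n > 1"
    by linarith
  then show ?case
  proof cases
    case 3
    then obtain p k where p: "prime p" "n = p * k"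
      by (metis dvdE less_irrefl prime_factor_nat)
    then have "k < n"
      using 3 prime_gt_1_nat[of p] by (cases "k = 0") simp_all
    moreover have "sum_four_squares (int p)"
      using p(1) by (simp add: sum_four_squares_prime)
    ultimately show ?thesis
      using less.IH sum_four_squares_mult p(2) by simp
  next
    case 1
    have "int n = 0\<^sup>2 + 0\<^sup>2 + 0\<^sup>2 + 0\<^sup>2"
      using 1 by simp
    then show ?thesis unfolding sum_four_squares_def by blast
  next
    case 2
    have "int n = 1\<^sup>2 + 0\<^sup>2 + 0\<^sup>2 + 0\<^sup>2"
      using 2 by simp
    then show ?thesis unfolding sum_four_squares_def by blast
  qed
qed

section \<open>Systems of equations from arithmetic expressions\<close>

text \<open>Every constructor other than \<open>Var\<close> is expressible by a single equation of
  \<open>E n\<close>; a difference is encoded by adding back the subtrahend.\<close>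

datatype (evars: 'v) expr =
    Var 'v
  | Const0
  | Const1
  | Plus "'v expr" "'v expr"
  | Minus "'v expr" "'v expr"
  | Times "'v expr" "'v expr"

primrec val :: "('v \<Rightarrow> int) \<Rightarrow> 'v expr \<Rightarrow> int" where
  "val a (Var v) = a v"
| "val a Const0 = 0"
| "val a Const1 = 1"
| "val a (Plus e g) = val a e + val a g"
| "val a (Minus e g) = val a e - val a g"
| "val a (Times e g) = val a e * val a g"

primrec subexprs :: "'v expr \<Rightarrow> 'v expr set" where
  "subexprs (Var v) = {Var v}"
| "subexprs Const0 = {Const0}"
| "subexprs Const1 = {Const1}"
| "subexprs (Plus e g) = insert (Plus e g) (subexprs e \<union> subexprs g)"
| "subexprs (Minus e g) = insert (Minus e g) (subexprs e \<union> subexprs g)"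
| "subexprs (Times e g) = insert (Times e g) (subexprs e \<union> subexprs g)"

text \<open>Counts repeated subexpressions separately, unlike the set \<open>subexprs\<close>. It
  gives an easily computed bound, while sharing matters only for \<open>half_num\<close>.\<close>

primrec nodes :: "'v expr \<Rightarrow> nat" where
  "nodes (Var v) = 1"
| "nodes Const0 = 1"
| "nodes Const1 = 1"
| "nodes (Plus e g) = nodes e + nodes g + 1"
| "nodes (Minus e g) = nodes e + nodes g + 1"
| "nodes (Times e g) = nodes e + nodes g + 1"

lemma val_cong: "(\<And>v. v \<in> evars e \<Longrightarrow> a v = b v) \<Longrightarrow> val a e = val b e"
  by (induction e) auto

lemma self_in_subexprs [simp]: "e \<in> subexprs e"
  by (cases e) auto

lemma finite_subexprs [simp]: "finite (subexprs e)"
  by (induction e) auto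

lemma subexprs_trans: "g \<in> subexprs e \<Longrightarrow> subexprs g \<subseteq> subexprs e"
  by (induction e) auto

lemma Var_in_subexprs_iff [simp]: "Var v \<in> subexprs e \<longleftrightarrow> v \<in> evars e"
  by (induction e) auto

lemma card_insert_Un_le: "card (insert x (A \<union> B)) \<le> card A + card B + 1"
  using card_insert_le_m1[of "card A + card B + 1" "A \<union> B" x] card_Un_le[of A B] by simp

lemma card_subexprs_le_nodes: "card (subexprs e) \<le> nodes e"
proof (induction e)
  case (Plus e g)
  then show ?case
    using card_insert_Un_le[of "Plus e g" "subexprs e" "subexprs g"] by simp
next
  case (Minus e g)
  then show ?case
    using card_insert_Un_le[of "Minus e g" "subexprs e" "subexprs g"] by simp
next
  case (Times e g)
  then show ?case
    using card_insert_Un_le[of "Times e g" "subexprs e" "subexprs g"] by simp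
qed simp_all

text \<open>Every expression \<open>e\<close> gets its own unknown, with index \<open>h e\<close>.\<close>

primrec node_eqs :: "('v expr \<Rightarrow> nat) \<Rightarrow> 'v expr \<Rightarrow> equation set" where
  "node_eqs h (Var v) = {}"
| "node_eqs h Const0 = {Sum (h Const0) (h Const0) (h Const0)}"
| "node_eqs h Const1 = {One (h Const1)}"
| "node_eqs h (Plus e g) = {Sum (h e) (h g) (h (Plus e g))}"
| "node_eqs h (Minus e g) = {Sum (h (Minus e g)) (h g) (h e)}"
| "node_eqs h (Times e g) = {Prod (h e) (h g) (h (Times e g))}"

section \<open>Values of expressions bounded by \<open>f\<close>\<close>

lemma solution_abs_le_f:
  assumes "S \<subseteq> E n" "finite (solutions n S)" "x \<in> solutions n S" "i \<in> {1..n}"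
  shows "\<bar>x i\<bar> \<le> int (f n)"
proof -
  have "\<forall>S. S \<subseteq> E n \<and> finite (solutions n S) \<longrightarrow>
          solutions n S \<subseteq> {1..n} \<rightarrow>\<^sub>E {- int (f n)..int (f n)}"
    unfolding f_def by (rule LeastI_ex[OF f_exists])
  then have "x \<in> {1..n} \<rightarrow>\<^sub>E {- int (f n)..int (f n)}"
    using assms(1-3) by blast
  then have "x i \<in> {- int (f n)..int (f n)}"
    using assms(4) by (rule PiE_mem)
  then show ?thesis
    by auto
qed

text \<open>One unknown per element of \<open>T\<close> fits into \<open>n\<close> indices. Closure
  under subexpressions lets the equations determine every unknown from those of the variables, so
  solutions correspond to assignments in \<open>A\<close> and are finite in number.\<close>

lemma abs_val_le_f:
  fixes T C :: "'v expr set"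
  defines "A \<equiv> {a \<in> {v. Var v \<in> T} \<rightarrow>\<^sub>E UNIV. \<forall>e\<in>C. val a e = 0}"
  assumes T: "finite T" "card T \<le> n" "\<And>e. e \<in> T \<Longrightarrow> subexprs e \<subseteq> T"
    and C: "C \<subseteq> T" and A: "finite A" and a: "a \<in> A" and e: "e \<in> T"
  shows "\<bar>val a e\<bar> \<le> int (f n)"
proof -
  obtain h where h: "inj_on h T" "h ` T \<subseteq> {1..n}"
    using card_le_inj[of T "{1..n}"] T by auto
  define S where "S = (\<Union>e\<in>T. node_eqs h e) \<union> (\<lambda>e. Sum (h e) (h e) (h e)) ` C
                      \<union> One ` ({1..n} - h ` T)"
  define ext where "ext = (\<lambda>b. \<lambda>i\<in>{1..n}. if i \<in> h ` T then val b (the_inv_into T h i) else 1)"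
  have h_in: "h e \<in> {1..n}" if "e \<in> T" for e
    using h(2) that by blast
  have sub: "Plus e g \<in> T \<Longrightarrow> e \<in> T \<and> g \<in> T" "Minus e g \<in> T \<Longrightarrow> e \<in> T \<and> g \<in> T"
    "Times e g \<in> T \<Longrightarrow> e \<in> T \<and> g \<in> T" for e g
    using T(3)[of "Plus e g"] T(3)[of "Minus e g"] T(3)[of "Times e g"] self_in_subexprs by auto
  have ext_h: "ext b (h e) = val b e" if "e \<in> T" for b e
    using h_in[OF that] that h(1) by (simp add: ext_def the_inv_into_f_f)
  have "node_eqs h e \<subseteq> E n" if "e \<in> T" for e
    using that h_in by (cases e) (auto simp: E_def dest!: sub)
  moreover have "Sum (h e) (h e) (h e) \<in> E n" if "e \<in> C" for e
    using that C h_in by (auto simp: E_def)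
  moreover have "One ` ({1..n} - h ` T) \<subseteq> E n"
    by (auto simp: E_def)
  ultimately have "S \<subseteq> E n"
    unfolding S_def by blast
  moreover have "solutions n S \<subseteq> ext ` A"
  proof
    fix x assume x: "x \<in> solutions n S"
    have sat: "satisfies x q" if "q \<in> S" for q
      using x that by (simp add: solutions_def)
    \<comment> \<open>The assignment is read off the unknowns of the variables and restricted, so
      that it is extensional as membership in \<open>A\<close> demands.\<close>
    define b where "b = (\<lambda>v\<in>{v. Var v \<in> T}. x (h (Var v)))"
    have node: "satisfies x q" if "e \<in> T" "q \<in> node_eqs h e" for e q
      using that by (intro sat) (auto simp: S_def)
    have val_b: "e \<in> T \<Longrightarrow> val b e = x (h e)" for e
    proof (induction e)
      case (Plus e g)
      then show ?case
        using node[OF Plus.prems] sub(1)[OF Plus.prems] Plus.IH by simp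
    next
      case (Minus e g)
      then show ?case
        using node[OF Minus.prems] sub(2)[OF Minus.prems] Minus.IH by (simp add: algebra_simps)
    next
      case (Times e g)
      then show ?case
        using node[OF Times.prems] sub(3)[OF Times.prems] Times.IH by simp
    next
      case (Var v)
      then show ?case
        by (simp add: b_def)
    next
      case Const0
      then show ?case
        using node[OF Const0] by simp
    next
      case Const1
      then show ?case
        using node[OF Const1] by simp
    qed
    have "b \<in> A"
    proof -
      have "val b e = 0" if "e \<in> C" for e
      proof -
        have "satisfies x (Sum (h e) (h e) (h e))"
          using that by (intro sat) (auto simp: S_def)
        then show ?thesis
          using that C val_b by auto
      qed
      then show ?thesis
        by (simp add: A_def b_def)
    qed
    moreover have "x = ext b"
    proof
      fix i
      consider "i \<notin> {1..n}" | "i \<in> h ` T" | "i \<in> {1..n} - h ` T"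
        by blast
      then show "x i = ext b i"
      proof cases
        case 1
        then show ?thesis
          using x by (auto simp: solutions_def ext_def)
      next
        case 2
        then show ?thesis
          using ext_h val_b by auto
      next
        case 3
        then have "satisfies x (One i)"
          by (intro sat) (auto simp: S_def)
        then show ?thesis
          using 3 by (simp add: ext_def)
      qed
    qed
    ultimately show "x \<in> ext ` A"
      by blast
  qed
  then have "finite (solutions n S)"
    using A finite_surj by blast
  moreover have "ext a \<in> solutions n S"
  proof -
    have "satisfies (ext a) q" if q: "q \<in> S" for q
    proof -
      consider (node) e where "e \<in> T" "q \<in> node_eqs h e"
        | (constr) e where "e \<in> C" "q = Sum (h e) (h e) (h e)"
        | (rest) i where "i \<in> {1..n} - h ` T" "q = One i"
        using q unfolding S_def by blast
      then show ?thesis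
      proof cases
        case node
        then show ?thesis
          using ext_h by (cases e) (auto dest!: sub)
      next
        case constr
        then show ?thesis
          using C a ext_h by (auto simp: A_def)
      next
        case rest
        then show ?thesis
          by (simp add: ext_def)
      qed
    qed
    then show ?thesis
      by (simp add: solutions_def ext_def)
  qed
  ultimately have "\<bar>ext a (h e)\<bar> \<le> int (f n)"
    using h_in[OF e] by (intro solution_abs_le_f)
  then show ?thesis
    using ext_h[OF e] by simp
qed

section \<open>Expressions for polynomials over the natural numbers\<close>

primrec num :: "nat \<Rightarrow> 'v expr" where
  "num 0 = Const0"
| "num (Suc k) = Plus (num k) Const1"

definition int_expr :: "int \<Rightarrow> 'v expr" where
  "int_expr c = (if c \<ge> 0 then num (nat c) else Minus Const0 (num (nat (- c))))"

text \<open>An expression for \<open>u\<close> with only about \<open>u / 2\<close> distinct subexpressions, so that a system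
  in \<open>u\<close> unknowns can define \<open>u\<close> and still has unknowns to spare.\<close>

definition half_num :: "nat \<Rightarrow> 'v expr" where
  "half_num u = Plus (Plus (num (u div 2)) (num (u div 2))) (num (u mod 2))"

primrec pow :: "'v expr \<Rightarrow> nat \<Rightarrow> 'v expr" where
  "pow e 0 = Const1"
| "pow e (Suc k) = Times e (pow e k)"

definition sum_expr :: "'v expr list \<Rightarrow> 'v expr" where
  "sum_expr es = foldr Plus es Const0"

definition prod_expr :: "'v expr list \<Rightarrow> 'v expr" where
  "prod_expr es = foldr Times es Const1"

text \<open>The natural unknown \<open>x\<^sub>i\<close> is the sum of the squares of the integer unknowns \<open>(i, 0), \<dots>, (i, 3)\<close>.\<close>

definition nat_var :: "nat \<Rightarrow> (nat \<times> nat) expr" where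
  "nat_var i = (let sq = \<lambda>j. Times (Var (i, j)) (Var (i, j))
                in Plus (Plus (sq 0) (sq 1)) (Plus (sq 2) (sq 3)))"

text \<open>All indices up to \<open>m\<close> occur, including those with exponent 0, so that the
  factors match the entries of the exponent list in \<open>encode_poly\<close>.\<close>

definition monom_expr :: "nat \<Rightarrow> int \<Rightarrow> (nat \<Rightarrow>\<^sub>0 nat) \<Rightarrow> (nat \<times> nat) expr" where
  "monom_expr m c \<mu> = Times (int_expr c)
     (prod_expr (map (\<lambda>i. pow (nat_var i) (Poly_Mapping.lookup \<mu> i)) [1..<Suc m]))"

definition poly_expr :: "nat \<Rightarrow> int_mpoly \<Rightarrow> (nat \<times> nat) expr" where
  "poly_expr m W = sum_expr (map (\<lambda>\<mu>. monom_expr m (Poly_Mapping.lookup W \<mu>) \<mu>)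
     (sorted_list_of_set (Poly_Mapping.keys W)))"

lemma val_num [simp]: "val a (num k) = int k"
  by (induction k) auto

lemma nodes_num [simp]: "nodes (num k) = 2 * k + 1"
  by (induction k) auto

lemma evars_num [simp]: "evars (num k) = {}"
  by (induction k) auto

text \<open>A unary numeral is a chain: its distinct subexpressions lie among \<open>Const1\<close>
  and the numerals up to \<open>k\<close>, about half of its nodes.\<close>

lemma card_subexprs_num: "card (subexprs (num k :: 'v expr)) \<le> k + 2"
proof -
  have "subexprs (num k) \<subseteq> insert Const1 (num ` {..k} :: 'v expr set)"
    by (induction k) (auto simp: atMost_Suc)
  then have "card (subexprs (num k :: 'v expr)) \<le> card (insert Const1 (num ` {..k} :: 'v expr set))"
    by (intro card_mono) auto
  also have "\<dots> \<le> Suc (card (num ` {..k} :: 'v expr set))"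
    by (simp add: card_insert_if)
  also have "\<dots> \<le> k + 2"
    using card_image_le[of "{..k}" "num :: nat \<Rightarrow> 'v expr"] by simp
  finally show ?thesis .
qed

lemma val_int_expr [simp]: "val a (int_expr c) = c"
  by (simp add: int_expr_def)

text \<open>The code of an integer is at least its absolute value, which governs the length of the
  unary numeral.\<close>

lemma nodes_int_expr: "nodes (int_expr c) \<le> 2 * int_encode c + 3"
  by (auto simp: int_expr_def int_encode_def sum_encode_def)

lemma evars_int_expr [simp]: "evars (int_expr c) = {}"
  by (simp add: int_expr_def)

lemma val_half_num [simp]: "val a (half_num u) = int u"
  by (simp add: half_num_def) presburger

lemma evars_half_num [simp]: "evars (half_num u) = {}"
  by (simp add: half_num_def)

text \<open>Both copies of the half share their at most \<open>u div 2 + 2\<close> subexpressions;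
  the doubling adds 1, the remainder at most 3 and the root 1.\<close>

lemma card_subexprs_half_num: "card (subexprs (half_num u :: 'v expr)) \<le> u div 2 + 7"
proof -
  let ?h = "num (u div 2) :: 'v expr" and ?r = "num (u mod 2) :: 'v expr"
  have "card (subexprs ?r) \<le> nodes ?r"
    by (rule card_subexprs_le_nodes)
  also have "\<dots> \<le> 3"
    using mod_less_divisor[of 2 u] by (simp del: mod_less_divisor)
  finally have "card (subexprs ?r) \<le> 3" .
  moreover have "card (insert (Plus ?h ?h) (subexprs ?h \<union> {})) \<le> card (subexprs ?h) + card ({} :: 'v expr set) + 1"
    by (rule card_insert_Un_le)
  ultimately show ?thesis
    using card_insert_Un_le[of "half_num u" "insert (Plus ?h ?h) (subexprs ?h)" "subexprs ?r"]
      card_subexprs_num[of "u div 2", where ?'v = 'v]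
    by (simp add: half_num_def)
qed

lemma val_pow [simp]: "val a (pow e k) = val a e ^ k"
  by (induction k) auto

lemma nodes_pow [simp]: "nodes (pow e k) = (nodes e + 1) * k + 1"
  by (induction k) auto

lemma evars_pow: "evars (pow e k) \<subseteq> evars e"
  by (induction k) auto

lemma val_sum_expr [simp]: "val a (sum_expr es) = sum_list (map (val a) es)"
  unfolding sum_expr_def by (induction es) auto

lemma nodes_sum_expr [simp]: "nodes (sum_expr es) = sum_list (map (\<lambda>e. nodes e + 1) es) + 1"
  unfolding sum_expr_def by (induction es) auto

lemma evars_sum_expr [simp]: "evars (sum_expr es) = (\<Union>e\<in>set es. evars e)"
  unfolding sum_expr_def by (induction es) auto

lemma val_prod_expr [simp]: "val a (prod_expr es) = prod_list (map (val a) es)"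
  unfolding prod_expr_def by (induction es) auto

lemma nodes_prod_expr [simp]: "nodes (prod_expr es) = sum_list (map (\<lambda>e. nodes e + 1) es) + 1"
  unfolding prod_expr_def by (induction es) auto

lemma evars_prod_expr [simp]: "evars (prod_expr es) = (\<Union>e\<in>set es. evars e)"
  unfolding prod_expr_def by (induction es) auto

lemma val_nat_var:
  "val a (nat_var i) = (a (i, 0))\<^sup>2 + (a (i, 1))\<^sup>2 + (a (i, 2))\<^sup>2 + (a (i, 3))\<^sup>2"
  by (simp add: nat_var_def power2_eq_square)

lemma val_nat_var_nonneg: "val a (nat_var i) \<ge> 0"
  by (simp add: val_nat_var)

lemma nodes_nat_var [simp]: "nodes (nat_var i) = 15"
  by (simp add: nat_var_def)

lemma evars_nat_var [simp]: "evars (nat_var i) = {i} \<times> {0, 1, 2, 3}"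
  by (auto simp: nat_var_def)

text \<open>Lagrange's theorem enters here, applied at every index at once.\<close>

lemma val_nat_var_surj: "\<exists>a. \<forall>i. val a (nat_var i) = int (y i)"
proof -
  have "\<exists>b :: nat \<Rightarrow> int. (b 0)\<^sup>2 + (b 1)\<^sup>2 + (b 2)\<^sup>2 + (b 3)\<^sup>2 = int (y i)" for i
  proof -
    obtain p q r s where "int (y i) = p\<^sup>2 + q\<^sup>2 + r\<^sup>2 + s\<^sup>2"
      using sum_four_squares_nat sum_four_squares_def by blast
    then show ?thesis
      by (intro exI[of _ "(!) [p, q, r, s]"]) (simp add: numeral_2_eq_2 numeral_3_eq_3)
  qed
  then obtain b :: "nat \<Rightarrow> nat \<Rightarrow> int"
    where "\<And>i. (b i 0)\<^sup>2 + (b i 1)\<^sup>2 + (b i 2)\<^sup>2 + (b i 3)\<^sup>2 = int (y i)"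
    by metis
  then show ?thesis
    by (intro exI[of _ "\<lambda>(i, j). b i j"]) (simp add: val_nat_var)
qed

lemma val_monom_expr:
  assumes "Poly_Mapping.keys \<mu> \<subseteq> {1..m}"
  shows "val a (monom_expr m c \<mu>) =
    c * (\<Prod>i\<in>Poly_Mapping.keys \<mu>. val a (nat_var i) ^ Poly_Mapping.lookup \<mu> i)"
proof -
  let ?g = "\<lambda>i. val a (nat_var i) ^ Poly_Mapping.lookup \<mu> i"
  have "prod_list (map ?g [1..<Suc m]) = (\<Prod>i\<in>set [1..<Suc m]. ?g i)"
    by (subst prod.distinct_set_conv_list) simp_all
  also have "\<dots> = (\<Prod>i\<in>{1..m}. ?g i)"
    by (rule prod.cong) auto
  also have "\<dots> = (\<Prod>i\<in>Poly_Mapping.keys \<mu>. ?g i)"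
    using assms by (intro prod.mono_neutral_right) (auto simp: in_keys_iff)
  finally show ?thesis
    by (simp add: monom_expr_def comp_def del: upt_Suc)
qed

lemma val_poly_expr:
  assumes "vars W \<subseteq> {1..m}"
  shows "val a (poly_expr m W) = eval_poly W (\<lambda>i. val a (nat_var i))"
proof -
  have "val a (monom_expr m (Poly_Mapping.lookup W \<mu>) \<mu>) = Poly_Mapping.lookup W \<mu> *
      (\<Prod>i\<in>Poly_Mapping.keys \<mu>. val a (nat_var i) ^ Poly_Mapping.lookup \<mu> i)"
    if "\<mu> \<in> Poly_Mapping.keys W" for \<mu>
    using that assms by (intro val_monom_expr) (auto simp: vars_def)
  then have "eval_poly W (\<lambda>i. val a (nat_var i)) =
      (\<Sum>\<mu>\<in>set (sorted_list_of_set (Poly_Mapping.keys W)).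
         val a (monom_expr m (Poly_Mapping.lookup W \<mu>) \<mu>))"
    unfolding eval_poly_def by (simp add: set_sorted_list_of_set)
  also have "\<dots> = val a (poly_expr m W)"
    unfolding poly_expr_def by (subst sum.distinct_set_conv_list) (simp_all add: comp_def)
  finally show ?thesis ..
qed

lemma eval_poly_cong:
  assumes "\<And>i. i \<in> vars W \<Longrightarrow> x i = y i"
  shows "eval_poly W x = eval_poly W y"
  unfolding eval_poly_def
proof (intro sum.cong refl arg_cong2[where f = "(*)"] prod.cong)
  fix \<mu> i assume "\<mu> \<in> Poly_Mapping.keys W" "i \<in> Poly_Mapping.keys \<mu>"
  then have "i \<in> vars W"
    unfolding vars_def by blast
  then show "x i ^ Poly_Mapping.lookup \<mu> i = y i ^ Poly_Mapping.lookup \<mu> i"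
    using assms by simp
qed

lemma evars_poly_expr: "evars (poly_expr m W) \<subseteq> {1..m} \<times> {0, 1, 2, 3}"
proof -
  have "evars (pow (nat_var i) k) \<subseteq> {i} \<times> {0, 1, 2, 3}" for i k
    using evars_pow[of "nat_var i" k] by simp
  then show ?thesis
    by (fastforce simp: poly_expr_def monom_expr_def simp del: upt_Suc)
qed

section \<open>Size of the polynomial's expression against its code\<close>

lemma add_le_prod_encode: "a + b \<le> prod_encode (a, b)"
proof -
  have "n \<le> triangle n" for n
    by (induction n) auto
  from this[of "a + b"] show ?thesis
    by (simp add: prod_encode_def)
qed

text \<open>Each list cell adds a successor to the code, which pays for a constant number of nodes
  per entry.\<close>

lemma sum_list_le_list_encode: "sum_list (map Suc xs) \<le> list_encode xs"
proof (induction xs)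
  case (Cons x xs)
  then show ?case
    using add_le_prod_encode[of x "list_encode xs"] by simp
qed simp

text \<open>The factor 16 is the cost of one unit of exponent: 15 nodes for \<open>nat_var\<close>
  and one for \<open>Times\<close>. The constant overheads are absorbed by the successors in the
  list codes.\<close>

lemma nodes_poly_expr: "nodes (poly_expr m W) \<le> 16 * encode_poly m W + 1"
proof -
  let ?M = "sorted_list_of_set (Poly_Mapping.keys W)"
  define es where "es = (\<lambda>\<mu> :: nat \<Rightarrow>\<^sub>0 nat. map (Poly_Mapping.lookup \<mu>) [1..<Suc m])"
  define code where "code = (\<lambda>\<mu>. prod_encode (int_encode (Poly_Mapping.lookup W \<mu>), list_encode (es \<mu>)))"
  have monom: "nodes (monom_expr m (Poly_Mapping.lookup W \<mu>) \<mu>) + 1 \<le> 16 * Suc (code \<mu>)" for \<mu>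
  proof -
    let ?c = "Poly_Mapping.lookup W \<mu>"
    have "nodes (monom_expr m ?c \<mu>) =
        nodes (int_expr ?c :: (nat \<times> nat) expr) + sum_list (map (\<lambda>k. 16 * k + 2) (es \<mu>)) + 2"
      by (simp add: monom_expr_def es_def comp_def del: upt_Suc)
    moreover have "sum_list (map (\<lambda>k. 16 * k + 2) (es \<mu>)) \<le> 16 * sum_list (map Suc (es \<mu>))"
      unfolding sum_list_const_mult[symmetric] map_map by (rule sum_list_mono) simp
    moreover have "nodes (int_expr ?c :: (nat \<times> nat) expr) \<le> 2 * int_encode ?c + 3"
      by (rule nodes_int_expr)
    moreover have "int_encode ?c + list_encode (es \<mu>) \<le> code \<mu>"
      unfolding code_def by (rule add_le_prod_encode)
    ultimately show ?thesis
      using sum_list_le_list_encode[of "es \<mu>"] by simp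
  qed
  have "nodes (poly_expr m W) =
      sum_list (map (\<lambda>\<mu>. nodes (monom_expr m (Poly_Mapping.lookup W \<mu>) \<mu>) + 1) ?M) + 1"
    by (simp add: poly_expr_def comp_def)
  also have "\<dots> \<le> sum_list (map (\<lambda>\<mu>. 16 * Suc (code \<mu>)) ?M) + 1"
    using monom by (intro add_right_mono sum_list_mono) blast
  also have "\<dots> = 16 * sum_list (map Suc (map code ?M)) + 1"
    by (simp only: sum_list_const_mult map_map comp_def)
  also have "\<dots> \<le> 16 * list_encode (map code ?M) + 1"
    using sum_list_le_list_encode[of "map code ?M"] by simp
  also have "\<dots> \<le> 16 * encode_poly m W + 1"
    using add_le_prod_encode[of m "list_encode (map code ?M)"]
    by (simp add: encode_poly_def code_def es_def del: upt_Suc)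
  finally show ?thesis .
qed

section \<open>Contradiction from finitely many zeros\<close>

lemma infinite_zeros_from:
  assumes m: "m \<ge> 2" and W: "vars W \<subseteq> {1..m}" and u: "u \<ge> 32 * encode_poly m W + 82"
    and repr: "\<And>x1 x2. (x1 \<ge> 1 \<and> x2 = f x1) \<longleftrightarrow> (\<exists>x. x \<in> zeros_from m W x1 x2)"
  shows "infinite (zeros_from m W u (f u))"
proof
  assume fin: "finite (zeros_from m W u (f u))"
  define P where "P = poly_expr m W"
  define Q where "Q = Minus (nat_var 1) (half_num u)"
  define R where "R = Plus (nat_var 2) Const1"
  define T where "T = subexprs P \<union> (subexprs Q \<union> subexprs R)"
  define V where "V = {v. Var v \<in> T}"
  define A where "A = {a \<in> V \<rightarrow>\<^sub>E UNIV. \<forall>e\<in>{P, Q}. val a e = 0}"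
  have V: "V = evars P \<union> evars Q \<union> evars R"
    by (auto simp: V_def T_def)
  then have V_sub: "V \<subseteq> {1..m} \<times> {0, 1, 2, 3}"
    using evars_poly_expr[of m W] m by (auto simp: P_def Q_def R_def)
  have "finite A"
  proof -
    \<comment> \<open>All values that the natural unknowns can take: \<open>u\<close>,
      \<open>f u\<close> and the coordinates of the finitely many zeros.\<close>
    define Y where "Y = insert u (insert (f u) (\<Union>x\<in>zeros_from m W u (f u). x ` {3..m}))"
    have Y: "finite Y"
      using fin by (simp add: Y_def)
    have "\<bar>a (i, j)\<bar> \<le> int (Max Y)" if a: "a \<in> A" and ij: "(i, j) \<in> V" for a i j
    proof -
      define y where "y = (\<lambda>i. nat (val a (nat_var i)))"
      have y: "val a (nat_var i) = int (y i)" for i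
        using val_nat_var_nonneg by (simp add: y_def)
      have y1: "y 1 = u"
        using a y[of 1] by (simp add: A_def Q_def)
      define x where "x = restrict y {3..m}"
      have x_y: "(x(1 := u, 2 := y 2)) i = y i" if "i \<in> {1..m}" for i
        using that y1 by (auto simp: x_def)
      have "eval_poly W (\<lambda>i. int ((x(1 := u, 2 := y 2)) i)) = eval_poly W (\<lambda>i. int (y i))"
      proof (rule eval_poly_cong)
        fix i assume "i \<in> vars W"
        then have "i \<in> {1..m}"
          using W by (rule subsetD[rotated])
        then show "int ((x(1 := u, 2 := y 2)) i) = int (y i)"
          by (simp only: x_y)
      qed
      also have "\<dots> = 0"
        using a val_poly_expr[OF W, of a] by (simp add: A_def P_def y)
      finally have "eval_poly W (\<lambda>i. int ((x(1 := u, 2 := y 2)) i)) = 0" .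
      moreover have "x \<in> {3..m} \<rightarrow>\<^sub>E UNIV"
        by (simp add: x_def)
      ultimately have x: "x \<in> zeros_from m W u (y 2)"
        unfolding zeros_from_def by blast
      \<comment> \<open>Although only \<open>P\<close> and \<open>Q\<close> are required to vanish,
        the representation hypothesis turns the existence of a zero into a determination of the
        second unknown.\<close>
      then have y2: "y 2 = f u"
        using repr by blast
      have i: "i \<in> {1..m}" and j: "j \<in> {0, 1, 2, 3}"
        using ij V_sub by auto
      have "i = 1 \<or> i = 2 \<or> i \<in> {3..m}"
        using i by auto
      then consider "i = 1" | "i = 2" | "i \<in> {3..m}"
        by blast
      then have "y i \<in> Y"
      proof cases
        case 3
        then have "y i = x i"
          by (simp add: x_def)
        then have "y i \<in> (\<Union>x\<in>zeros_from m W u (f u). x ` {3..m})"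
          using x y2 3 by (intro UN_I[of x]) simp_all
        then show ?thesis
          by (simp add: Y_def)
      next
        case 1
        then have "y i = u"
          using y1 by blast
        then show ?thesis
          by (simp add: Y_def)
      next
        case 2
        then have "y i = f u"
          using y2 by blast
        then show ?thesis
          by (simp add: Y_def)
      qed
      then have "y i \<le> Max Y"
        using Y by simp
      \<comment> \<open>An integer is at most its square in absolute value, and each square is at
        most the sum \<open>y i\<close>; thus bounding the natural unknowns bounds their
        roots.\<close>
      moreover have "\<bar>a (i, j)\<bar> \<le> (a (i, j))\<^sup>2"
        using self_le_power[of "\<bar>a (i, j)\<bar>" 2] by (cases "a (i, j) = 0") simp_all
      moreover have "(a (i, j))\<^sup>2 \<le> val a (nat_var i)"
        using j by (auto simp: val_nat_var)
      ultimately show ?thesis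
        using y[of i] by linarith
    qed
    then have bound: "\<bar>a v\<bar> \<le> int (Max Y)" if "a \<in> A" "v \<in> V" for a v
      using that by (cases v) blast
    have "A \<subseteq> V \<rightarrow>\<^sub>E {- int (Max Y)..int (Max Y)}"
    proof
      fix a assume a: "a \<in> A"
      show "a \<in> V \<rightarrow>\<^sub>E {- int (Max Y)..int (Max Y)}"
      proof (rule PiE_I)
        fix v assume "v \<in> V"
        from bound[OF a this] show "a v \<in> {- int (Max Y)..int (Max Y)}"
          by auto
      next
        fix v assume v: "v \<notin> V"
        have "a \<in> V \<rightarrow>\<^sub>E UNIV"
          using a by (simp add: A_def)
        then show "a v = undefined"
          using v by (rule PiE_arb)
      qed
    qed
    moreover have "finite V"
      using V_sub by (rule finite_subset) simp
    ultimately show ?thesis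
      using finite_subset[OF _ finite_PiE] by blast
  qed
  \<comment> \<open>The converse direction of the hypothesis, available since \<open>u\<close> is
    positive, makes the system solvable.\<close>
  obtain x where x: "x \<in> zeros_from m W u (f u)"
    using repr[of u "f u"] u by auto
  define y where "y = x(1 := u, 2 := f u)"
  obtain a where a: "\<And>i. val a (nat_var i) = int (y i)"
    using val_nat_var_surj[of y] by blast
  define b where "b = restrict a V"
  have val_b: "val b e = val a e" if "evars e \<subseteq> V" for e
    by (rule val_cong) (use that b_def in auto)
  have sub: "evars P \<subseteq> V" "evars Q \<subseteq> V" "evars R \<subseteq> V"
    unfolding V by blast+
  have "val a P = 0"
    using val_poly_expr[OF W, of a] x a by (simp add: P_def zeros_from_def y_def)
  then have "val b P = 0"
    using val_b sub by simp
  moreover have "val b Q = 0"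
    using val_b[OF sub(2)] a[of 1] by (simp add: Q_def y_def)
  ultimately have "b \<in> A"
    by (simp add: A_def b_def)
  have "val b R = int (f u) + 1"
    using val_b[OF sub(3)] a[of 2] by (simp add: R_def y_def)
  moreover have "\<bar>val b R\<bar> \<le> int (f u)"
  proof (rule abs_val_le_f)
    show "finite T" "{P, Q} \<subseteq> T" "R \<in> T"
      by (simp_all add: T_def)
    show "subexprs e \<subseteq> T" if e: "e \<in> T" for e
    proof -
      obtain g where "g \<in> {P, Q, R}" "e \<in> subexprs g"
        using e by (auto simp: T_def)
      then have "subexprs e \<subseteq> subexprs g"
        by (intro subexprs_trans)
      then show ?thesis
        using \<open>g \<in> {P, Q, R}\<close> by (auto simp: T_def)
    qed
    have "card T \<le> card (subexprs P) + (card (subexprs Q) + card (subexprs R))"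
      unfolding T_def by (rule order_trans[OF card_Un_le add_left_mono[OF card_Un_le]])
    moreover have "card (subexprs P) \<le> 16 * encode_poly m W + 1"
      unfolding P_def by (rule order_trans[OF card_subexprs_le_nodes nodes_poly_expr])
    moreover have "card (subexprs Q) \<le> 15 + (u div 2 + 7) + 1"
      using card_insert_Un_le[of Q "subexprs (nat_var 1)" "subexprs (half_num u)"]
        card_subexprs_le_nodes[of "nat_var 1"] card_subexprs_half_num[of u, where ?'v = "nat \<times> nat"]
      by (simp add: Q_def)
    moreover have "card (subexprs R) \<le> 17"
      using card_subexprs_le_nodes[of R] by (simp add: R_def)
    \<comment> \<open>The three counts add up to at most
      \<open>16 * encode_poly m W + 41 + u div 2\<close>; the threshold on \<open>u\<close> is twice
      the part without \<open>u\<close>.\<close>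
    ultimately show "card T \<le> u"
      using u by linarith
    show "finite {a \<in> {v. Var v \<in> T} \<rightarrow>\<^sub>E UNIV. \<forall>e\<in>{P, Q}. val a e = 0}"
      "b \<in> {a \<in> {v. Var v \<in> T} \<rightarrow>\<^sub>E UNIV. \<forall>e\<in>{P, Q}. val a e = 0}"
      using \<open>finite A\<close> \<open>b \<in> A\<close> unfolding A_def V_def .
  qed
  ultimately show False
    by simp
qed

section \<open>A program computing the threshold\<close>

definition add_const :: "nat \<Rightarrow> program \<Rightarrow> program" where
  "add_const k = (\<lambda>p. Comp Succ [p]) ^^ k"

lemma computes_add_const: "computes p xs y \<Longrightarrow> computes (add_const k p) xs (y + k)"
proof (induction k)
  case (Suc k)
  then have "computes (Comp Succ [add_const k p]) xs (Suc (y + k))"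
    by (intro computes.comp[where ys = "[y + k]"] computes.succ) simp_all
  then show ?case
    by (simp add: add_const_def)
qed (simp add: add_const_def)

text \<open>Recursion starts at \<open>b\<close> and adds \<open>a\<close> in each of
  \<open>n\<close> rounds. As the threshold is linear in the code, the program never has to decode
  the polynomial.\<close>

lemma computes_linear:
  "computes (PrimRec (add_const b Zero) (add_const a (Proj 1))) [n] (a * n + b)"
proof (induction n)
  case 0
  show ?case
    using computes_add_const[OF computes.zero, of b "[]"] by (auto intro: computes.prim_0)
next
  case (Suc n)
  let ?r = "a * n + b"
  \<comment> \<open>The step program receives the counter at position 0 and the previous value at
    position 1.\<close>
  have "computes (Proj 1) [n, ?r] ?r"
    using computes.proj[of 1 "[n, ?r]"] by simp
  then have "computes (add_const a (Proj 1)) [n, ?r] (?r + a)"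
    by (rule computes_add_const)
  then show ?case
    using computes.prim_Suc[OF Suc] by (simp add: algebra_simps)
qed

theorem theorem3:
  shows "\<exists>p :: program. \<forall>(m :: nat) (W :: int_mpoly). m \<ge> 2 \<and> vars W \<subseteq> {1..m} \<longrightarrow>
    (\<exists>v :: nat. v > 0 \<and> computes p [encode_poly m W] v \<and>
      ((\<forall>x1 x2 :: nat. (x1 \<ge> 1 \<and> x2 = f x1) \<longleftrightarrow> (\<exists>x. x \<in> zeros_from m W x1 x2)) \<longrightarrow>
       (\<forall>u\<ge>v. infinite (zeros_from m W u (f u)))))"
proof (intro exI allI impI conjI)
  fix m :: nat and W :: int_mpoly and u :: nat
  assume mW: "m \<ge> 2 \<and> vars W \<subseteq> {1..m}"
  show "0 < 32 * encode_poly m W + 82"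
    by simp
  show "computes (PrimRec (add_const 82 Zero) (add_const 32 (Proj 1))) [encode_poly m W]
          (32 * encode_poly m W + 82)"
    by (rule computes_linear)
  assume "\<forall>x1 x2. (x1 \<ge> 1 \<and> x2 = f x1) \<longleftrightarrow> (\<exists>x. x \<in> zeros_from m W x1 x2)"
    and "32 * encode_poly m W + 82 \<le> u"
  then show "infinite (zeros_from m W u (f u))"
    using mW by (intro infinite_zeros_from) blast+
qed

end
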